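(* For every integer $n>0$, let $b=\lfloor \log_2 n\rfloor$ and $c=n+1-2^{b}$. Then $a_4(n)=2^{3b}+6c^2\,2^{b}+a_4(c-1)$.
   Context: A P-position of the game of Nim with $k$ piles is a $k$-tuple $(p_1,\dots,p_k)$ of non-negative integers whose nim-sum $p_1\oplus\cdots\oplus p_k$ is $0$, where $\oplus$ denotes bitwise XOR. $a_k(m)$ denotes the number of P-positions with $k$ piles such that every pile has at most $m$ counters, for $m\ge 0$ (so $a_k(0)=1$). *)

theory Defs
  imports Complex_Main
begin

unbundle bit_operations_syntax

definition nim_sum :: "nat list \<Rightarrow> nat" where
  "nim_sum ps = foldr (XOR) ps 0"

(* A position with k piles is an ordered k-tuple, represented as a list of length k. *)
definition P_position :: "nat \<Rightarrow> nat list \<Rightarrow> bool" where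
  "P_position k ps \<longleftrightarrow> length ps = k \<and> nim_sum ps = 0"

definition num_P_positions :: "nat \<Rightarrow> nat \<Rightarrow> nat" where
  "num_P_positions k m = card {ps. P_position k ps \<and> (\<forall>p\<in>set ps. p \<le> m)}"

(* The cardinality above is taken over a finite set. *)
lemma finite_bounded_P_positions:
  "finite {ps. P_position k ps \<and> (\<forall>p\<in>set ps. p \<le> m)}"
proof (rule finite_subset)
  show "{ps. P_position k ps \<and> (\<forall>p\<in>set ps. p \<le> m)} \<subseteq> {ps. set ps \<subseteq> {..m} \<and> length ps = k}"
    by (auto simp: P_position_def)
  show "finite {ps. set ps \<subseteq> {..m} \<and> length ps = k}"
    by (rule finite_lists_length_eq) simp
qed

end

theory Submission
  imports Defs
begin

text \<open>Group the four piles into two pairs: a P-position is a choice of two pairs with the same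
  nim-sum \<open>s\<close>, so the number of P-positions with piles below \<open>M\<close> is the sum of the
  squares of \<open>r M s\<close>, the number of pairs below \<open>M\<close> with nim-sum \<open>s\<close>.
  With \<open>N = 2 ^ b\<close> and \<open>c \<le> N\<close> one has \<open>r (N + c) s = N + r c s\<close> and
  \<open>r (N + c) (N + s) = 2 * c\<close> for \<open>s < N\<close>. Squaring and summing gives the recursion,
  because the \<open>r c s\<close> add up to \<open>c\<^sup>2\<close> and their squares to the number of
  P-positions with piles below \<open>c\<close>.\<close>

lemma xor_xor_cancel_right: "(x XOR s) XOR s = (x :: nat)"
  by (simp add: xor.assoc)

lemma xor_xor_cancel_left: "x XOR (x XOR s) = (s :: nat)"
  by (simp flip: xor.assoc)

lemma xor_eq_0_iff_nat: "x XOR y = 0 \<longleftrightarrow> x = (y :: nat)"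
  by (metis xor_xor_cancel_right xor_self_eq xor.left_neutral)

lemma xor_less_exp_nat:
  assumes "x < 2 ^ k" "y < 2 ^ k"
  shows "x XOR y < (2 ^ k :: nat)"
  using assms by (metis take_bit_nat_eq_self_iff take_bit_xor)

text \<open>Bit \<open>k\<close> of \<open>x\<close> is clear, so the addition produces no
  carry.\<close>

lemma exp_add_eq_xor_nat:
  assumes "x < 2 ^ k"
  shows "2 ^ k + x = (2 ^ k XOR x :: nat)"
proof (rule disjunctive_add_eq_xor)
  have "\<not> bit x k"
    using assms by (metis bit_take_bit_iff less_irrefl take_bit_nat_eq_self_iff)
  then show "2 ^ k AND x = 0"
    by (auto intro!: bit_eqI simp: bit_simps)
qed

lemma exp_add_xor_nat:
  assumes "x < 2 ^ k" "y < 2 ^ k"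
  shows "(2 ^ k + x) XOR y = (2 ^ k + (x XOR y) :: nat)"
    and "x XOR (2 ^ k + y) = (2 ^ k + (x XOR y) :: nat)"
    and "(2 ^ k + x) XOR (2 ^ k + y) = (x XOR y :: nat)"
  using assms xor_less_exp_nat[OF assms]
  by (simp_all only: exp_add_eq_xor_nat xor.assoc xor.commute xor.left_commute
      xor_xor_cancel_left xor_self_eq xor.left_neutral xor.right_neutral)

text \<open>The first components of the pairs below \<open>M\<close> with nim-sum \<open>s\<close>.\<close>
definition xor_pairs :: "nat \<Rightarrow> nat \<Rightarrow> nat set" where
  "xor_pairs M s = {x. x < M \<and> x XOR s < M}"

lemma finite_xor_pairs [simp]: "finite (xor_pairs M s)"
  by (simp add: xor_pairs_def)

text \<open>The bound \<open>2 ^ k\<close> only has to exceed every nim-sum of two piles. Leaving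
  \<open>k\<close> free allows the use of one exponent for \<open>2 ^ k + m\<close> and a smaller
  one for \<open>m\<close>.\<close>

lemma num_P_positions_4_eq_sum:
  assumes "m < 2 ^ k"
  shows "num_P_positions 4 m = (\<Sum>s<2 ^ k. (card (xor_pairs (Suc m) s))\<^sup>2)"
proof -
  let ?X = "xor_pairs (Suc m)"
  let ?f = "\<lambda>(s, x, y). [x, x XOR s, y, y XOR s]"
  have "bij_betw ?f (SIGMA s:{..<2 ^ k}. ?X s \<times> ?X s)
          {ps. P_position 4 ps \<and> (\<forall>p\<in>set ps. p \<le> m)}"
    unfolding bij_betw_def
  proof (intro conjI subset_antisym)
    show "inj_on ?f (SIGMA s:{..<2 ^ k}. ?X s \<times> ?X s)"
      \<comment> \<open>The nim-sum \<open>s\<close> is recovered from the first two piles as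
        \<open>x XOR (x XOR s)\<close>.\<close>
      by (auto simp: inj_on_def) (metis xor_xor_cancel_left)
    show "?f ` (SIGMA s:{..<2 ^ k}. ?X s \<times> ?X s)
            \<subseteq> {ps. P_position 4 ps \<and> (\<forall>p\<in>set ps. p \<le> m)}"
      by (auto simp: P_position_def nim_sum_def xor_pairs_def xor_xor_cancel_left
          simp flip: xor.assoc)
    show "{ps. P_position 4 ps \<and> (\<forall>p\<in>set ps. p \<le> m)}
            \<subseteq> ?f ` (SIGMA s:{..<2 ^ k}. ?X s \<times> ?X s)"
    proof
      fix ps assume ps: "ps \<in> {ps. P_position 4 ps \<and> (\<forall>p\<in>set ps. p \<le> m)}"
      then obtain w x y z where [simp]: "ps = [w, x, y, z]"
        by (auto simp: P_position_def numeral_eq_Suc length_Suc_conv)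
      have le: "w \<le> m" "x \<le> m" "y \<le> m" "z \<le> m"
        using ps by auto
      have eq: "w XOR x = y XOR z"
        using ps xor_eq_0_iff_nat[of "w XOR x" "y XOR z"]
        by (simp add: P_position_def nim_sum_def ac_simps)
      have x: "x = w XOR (w XOR x)"
        by (simp only: xor_xor_cancel_left)
      have z: "z = y XOR (w XOR x)"
        by (simp only: eq xor_xor_cancel_left)
      have "ps = ?f (w XOR x, w, y)"
        using x z by simp
      moreover have "(w XOR x, w, y) \<in> (SIGMA s:{..<2 ^ k}. ?X s \<times> ?X s)"
        using le assms x z xor_less_exp_nat[of w k x] by (simp add: xor_pairs_def less_Suc_eq_le)
      ultimately show "ps \<in> ?f ` (SIGMA s:{..<2 ^ k}. ?X s \<times> ?X s)"
        by (rule image_eqI)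
    qed
  qed
  from bij_betw_same_card[OF this] show ?thesis
    by (simp add: num_P_positions_def card_cartesian_product power2_eq_square)
qed

text \<open>Every pair in the square \<open>{..<c} \<times> {..<c}\<close> has exactly one nim-sum,
  and it is below \<open>2 ^ k\<close>, so the square is partitioned by nim-sum.\<close>

lemma sum_card_xor_pairs:
  assumes "c \<le> 2 ^ k"
  shows "(\<Sum>s<2 ^ k. card (xor_pairs c s)) = c\<^sup>2"
proof -
  have less: "x XOR y < 2 ^ k" if "x < c" "y < c" for x y
    using that assms by (intro xor_less_exp_nat) simp_all
  have "bij_betw (\<lambda>(s, x). (x, x XOR s)) (SIGMA s:{..<2 ^ k}. xor_pairs c s) ({..<c} \<times> {..<c})"
    by (rule bij_betw_byWitness[where f' = "\<lambda>(x, y). (x XOR y, x)"])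
      (auto simp: xor_pairs_def xor_xor_cancel_left less)
  from bij_betw_same_card[OF this] show ?thesis
    by (simp add: power2_eq_square)
qed

text \<open>Since \<open>s\<close> has no bit \<open>k\<close>, both components lie below
  \<open>2 ^ k\<close> or neither does. Every \<open>x < 2 ^ k\<close> qualifies; the other pairs
  are the pairs below \<open>c\<close> with \<open>2 ^ k\<close> added to both components.\<close>

lemma card_xor_pairs_low:
  assumes "c \<le> 2 ^ k" "s < 2 ^ k"
  shows "card (xor_pairs (2 ^ k + c) s) = 2 ^ k + card (xor_pairs c s)"
proof -
  have "xor_pairs (2 ^ k + c) s = {..<2 ^ k} \<union> (+) (2 ^ k) ` xor_pairs c s" (is "?L = ?R")
  proof (intro set_eqI)
    fix x
    show "x \<in> ?L \<longleftrightarrow> x \<in> ?R"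
    proof (cases "x < 2 ^ k")
      case True
      then show ?thesis
        using xor_less_exp_nat[OF True assms(2)] by (auto simp: xor_pairs_def)
    next
      case False
      then obtain y where "x = 2 ^ k + y"
        by (metis le_Suc_ex not_less)
      then show ?thesis
        using assms by (auto simp: xor_pairs_def exp_add_xor_nat image_iff)
    qed
  qed
  also have "card \<dots> = 2 ^ k + card (xor_pairs c s)"
    by (subst card_Un_disjoint) (auto simp: card_image)
  finally show ?thesis .
qed

text \<open>Here bit \<open>k\<close> is flipped, so exactly one component has the form
  \<open>2 ^ k + y\<close>, with \<open>y < c\<close>, and it determines the other. It may be the
  second component (left set of the union) or the first (right set).\<close>

lemma card_xor_pairs_high:
  assumes "c \<le> 2 ^ k" "s < 2 ^ k"
  shows "card (xor_pairs (2 ^ k + c) (2 ^ k + s)) = 2 * c"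
proof -
  have less: "y XOR s < 2 ^ k" if "y < c" for y
    using that assms by (intro xor_less_exp_nat) simp_all
  have "xor_pairs (2 ^ k + c) (2 ^ k + s) = (\<lambda>y. y XOR s) ` {..<c} \<union> (+) (2 ^ k) ` {..<c}"
    (is "?L = ?R")
  proof (intro set_eqI)
    fix x
    show "x \<in> ?L \<longleftrightarrow> x \<in> ?R"
    proof (cases "x < 2 ^ k")
      case True
      have "x \<in> (\<lambda>y. y XOR s) ` {..<c} \<longleftrightarrow> x XOR s < c"
        using image_eqI[of x "\<lambda>y. y XOR s" "x XOR s" "{..<c}"]
        by (auto simp: xor_xor_cancel_right)
      then show ?thesis
        using True assms by (auto simp: xor_pairs_def exp_add_xor_nat)
    next
      case False
      then obtain y where y: "x = 2 ^ k + y"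
        by (metis le_Suc_ex not_less)
      have "x \<notin> (\<lambda>y. y XOR s) ` {..<c}"
        using False less by auto
      then show ?thesis
        using y assms less[of y] by (auto simp: xor_pairs_def exp_add_xor_nat image_iff)
    qed
  qed
  also have "card \<dots> = card ((\<lambda>y. y XOR s) ` {..<c}) + card ((+) (2 ^ k) ` {..<c})"
    using less by (intro card_Un_disjoint) fastforce+
  also have "\<dots> = 2 * c"
    \<comment> \<open>XOR with \<open>s\<close> is its own inverse, hence injective.\<close>
    using inj_on_inverseI[of "{..<c}" "\<lambda>y. y XOR s" "\<lambda>y. y XOR s"]
    by (simp add: card_image xor_xor_cancel_right)
  finally show ?thesis .
qed

lemma sum_lessThan_add:
  fixes f :: "nat \<Rightarrow> 'a :: comm_monoid_add"
  shows "sum f {..<m + n} = sum f {..<m} + (\<Sum>i<n. f (m + i))"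
  by (induction n) (simp_all add: ac_simps)

lemma num_P_positions_4_exp_add:
  assumes "m < 2 ^ k"
  shows "num_P_positions 4 (2 ^ k + m) =
    2 ^ (3 * k) + 6 * (Suc m)\<^sup>2 * 2 ^ k + num_P_positions 4 m"
proof -
  let ?N = "2 ^ k :: nat" and ?c = "Suc m"
  let ?r = "\<lambda>M s. card (xor_pairs M s)"
  have c: "?c \<le> ?N" using assms by simp
  have "num_P_positions 4 (?N + m) = (\<Sum>s<?N + ?N. (?r (?N + ?c) s)\<^sup>2)"
    \<comment> \<open>As \<open>2 ^ k + m < 2 ^ Suc k\<close>, the nim-sums range over two blocks of
      length \<open>2 ^ k\<close>, told apart by bit \<open>k\<close>.\<close>
    using assms by (subst num_P_positions_4_eq_sum[of _ "Suc k"]) (simp_all add: mult_2)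
  also have "\<dots> = (\<Sum>s<?N. (?r (?N + ?c) s)\<^sup>2) + (\<Sum>s<?N. (?r (?N + ?c) (?N + s))\<^sup>2)"
    by (rule sum_lessThan_add)
  also have "\<dots> = (\<Sum>s<?N. (?N + ?r ?c s)\<^sup>2) + (\<Sum>s<?N. (2 * ?c)\<^sup>2)"
    by (intro arg_cong2[where f = "(+)"] sum.cong)
      (simp_all only: card_xor_pairs_low[OF c] card_xor_pairs_high[OF c] lessThan_iff)
  also have "(\<Sum>s<?N. (?N + ?r ?c s)\<^sup>2)
      = ?N * ?N\<^sup>2 + 2 * ?N * (\<Sum>s<?N. ?r ?c s) + (\<Sum>s<?N. (?r ?c s)\<^sup>2)"
    by (simp add: power2_sum sum.distrib sum_distrib_left ac_simps)
  also have "(\<Sum>s<?N. ?r ?c s) = ?c\<^sup>2"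
    using c by (rule sum_card_xor_pairs)
  also have "(\<Sum>s<?N. (?r ?c s)\<^sup>2) = num_P_positions 4 m"
    using assms by (simp only: num_P_positions_4_eq_sum)
  also have "?N * ?N\<^sup>2 = 2 ^ (3 * k)"
    by (simp add: power_mult power2_eq_square power3_eq_cube mult.commute[of 3])
  finally show ?thesis
    by (simp only: sum_constant card_lessThan power_mult_distrib) (simp add: algebra_simps)
qed

theorem theorem13:
  fixes n b c :: nat
  assumes "n > 0"
    and "b = nat \<lfloor>log 2 (real n)\<rfloor>"
    and "c = n + 1 - 2 ^ b"
  shows "num_P_positions 4 n = 2 ^ (3 * b) + 6 * c\<^sup>2 * 2 ^ b + num_P_positions 4 (c - 1)"
proof -
  \<comment> \<open>For \<open>n \<ge> 1\<close> the logarithm is nonnegative, so \<open>nat\<close>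
    loses nothing.\<close>
  have "\<lfloor>log 2 (real n)\<rfloor> = int b"
    using assms(1,2) by simp
  then have n: "2 ^ b \<le> n" "n < 2 ^ (b + 1)"
    using floor_log_nat_eq_powr_iff[of 2 n b] assms(1) by simp_all
  \<comment> \<open>Piles of at most \<open>m\<close> are piles below \<open>c = Suc m\<close>,
    which accounts for the \<open>c - 1\<close> in the claim. The subtraction is not truncated
    because \<open>2 ^ b \<le> n\<close>.\<close>
  define m where "m = n - 2 ^ b"
  have "n = 2 ^ b + m" "m < 2 ^ b" "c = Suc m"
    using n assms(3) by (simp_all add: m_def)
  then show ?thesis
    using num_P_positions_4_exp_add[of m b] by simp
qed

end
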